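(* Let $\nu, m_1, m_2, t$ be positive integers with $m_1\ge m_2\ge t$ and $2\nu\ge 2m_1+m_2+1$. Suppose $\mathcal F_1\subseteq\mathcal P_{m_1}$ and $\mathcal F_2\subseteq\mathcal P_{m_2}$ are cross $t$-intersecting families such that $|\mathcal F_1|\cdot|\mathcal F_2|$ is maximum among all pairs of cross $t$-intersecting families $\mathcal F_1\subseteq\mathcal P_{m_1}$, $\mathcal F_2\subseteq\mathcal P_{m_2}$. Then there exists a $t$-dimensional totally isotropic subspace contained in every member of $\mathcal F_1$ and of $\mathcal F_2$.
   Context: Let $q$ be a prime power, $\nu\ge 1$ an integer, and $f$ a non-degenerate alternating bilinear form on $V=\mathbb F_q^{2\nu}$. A subspace $W\le V$ is totally isotropic if $f(x,y)=0$ for all $x,y\in W$ (maximal totally isotropic subspaces have dimension $\nu$). For $0\le m\le \nu$, $\mathcal P_m$ denotes the set of all $m$-dimensional totally isotropic subspaces of $V$. Families $\mathcal F_1\subseteq\mathcal P_{m_1}$ and $\mathcal F_2\subseteq\mathcal P_{m_2}$ are called cross $t$-intersecting if $\dim(F_1\cap F_2)\ge t$ for all $F_1\in\mathcal F_1$, $F_2\in\mathcal F_2$. *)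

theory Defs
  imports "HOL-Analysis.Analysis"
begin

text \<open>The ambient space V = F_q^(2 nu) is modelled as 'a ^ 'n with 'a a finite field
  and CARD('n) = 2 nu; subspaces are sets of vectors, dimension is vec.dim.\<close>

definition bilinear_form :: "('a::field ^ 'n \<Rightarrow> 'a ^ 'n \<Rightarrow> 'a) \<Rightarrow> bool" where
  "bilinear_form f \<longleftrightarrow>
     (\<forall>x y z. f (x + y) z = f x z + f y z) \<and>
     (\<forall>x y z. f x (y + z) = f x y + f x z) \<and>
     (\<forall>c x y. f (c *s x) y = c * f x y) \<and>
     (\<forall>c x y. f x (c *s y) = c * f x y)"

definition alternating_form :: "('a::field ^ 'n \<Rightarrow> 'a ^ 'n \<Rightarrow> 'a) \<Rightarrow> bool" where
  "alternating_form f \<longleftrightarrow> (\<forall>x. f x x = 0)"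

definition nondegenerate_form :: "('a::field ^ 'n \<Rightarrow> 'a ^ 'n \<Rightarrow> 'a) \<Rightarrow> bool" where
  "nondegenerate_form f \<longleftrightarrow> (\<forall>x. (\<forall>y. f x y = 0) \<longrightarrow> x = 0)"

definition totally_isotropic :: "('a::field ^ 'n \<Rightarrow> 'a ^ 'n \<Rightarrow> 'a) \<Rightarrow> ('a ^ 'n) set \<Rightarrow> bool" where
  "totally_isotropic f W \<longleftrightarrow> vec.subspace W \<and> (\<forall>x\<in>W. \<forall>y\<in>W. f x y = 0)"

definition iso_subspaces :: "('a::field ^ 'n \<Rightarrow> 'a ^ 'n \<Rightarrow> 'a) \<Rightarrow> nat \<Rightarrow> ('a ^ 'n) set set" where
  "iso_subspaces f m = {W. totally_isotropic f W \<and> vec.dim W = m}"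

definition cross_t_intersecting :: "('a::field ^ 'n) set set \<Rightarrow> ('a ^ 'n) set set \<Rightarrow> nat \<Rightarrow> bool" where
  "cross_t_intersecting F1 F2 t \<longleftrightarrow> (\<forall>A\<in>F1. \<forall>B\<in>F2. t \<le> vec.dim (A \<inter> B))"

end

theory Submission
  imports Defs
begin

text \<open>A \<open>t\<close>-cover of a family is a subspace meeting every member in dimension at least \<open>t\<close>; let \<open>\<sigma>\<close> and
  \<open>\<tau>\<close> be the least dimensions of \<open>t\<close>-covers of \<open>F1\<close> and \<open>F2\<close>. Members of each family cover the other,
  so \<open>\<sigma> \<le> m2\<close> and \<open>\<tau> \<le> m1\<close>. Every member of \<open>F1\<close> contains a \<open>t\<close>-subspace of a least cover of \<open>F1\<close>,
  and as long as a subspace does not cover \<open>F2\<close>, the members of \<open>F1\<close> above it contain one of fewer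
  than \<open>q ^ (m2 - t + 1)\<close> extensions by one dimension. This bounds \<open>card F1\<close>, and symmetrically
  \<open>card F2\<close>. Regrouping the product of the two bounds so that the \<open>t\<close>-subspaces of one cover are
  charged against the dimension steps of the same cover, the dimension hypothesis makes the product
  smaller than that of the trivial pair (everything above a fixed \<open>t\<close>-space) unless
  \<open>\<sigma> = \<tau> = t\<close>. Then all of \<open>F1\<close> contains one \<open>t\<close>-space, and if it failed to lie in some member of \<open>F2\<close>,
  one more extension step would again give a smaller product.\<close>

section \<open>Subspaces of a finite vector space\<close>

lemma card_subspace:
  fixes W :: "('a::{field,finite} ^ 'n) set"
  assumes "vec.subspace W"
  shows "card W = CARD('a) ^ vec.dim W"
proof -
  have "card (vec.span B) = CARD('a) ^ card B" if "finite B" "vec.independent B" for B :: "('a^'n) set"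
    using that
  proof (induction B rule: finite_induct)
    case empty
    then show ?case by simp
  next
    case (insert b B)
    have ind: "vec.independent B" and b: "b \<notin> vec.span B"
      using insert.prems insert.hyps by (auto simp: vec.independent_insert)
    \<comment> \<open>Adjoining \<open>b\<close> multiplies the size of the span by the field size,
      since each vector of the larger span is \<open>k *s b + w\<close> in exactly one way.\<close>
    let ?h = "\<lambda>(k::'a, w). k *s b + w"
    have inj: "inj_on ?h (UNIV \<times> vec.span B)"
    proof (rule inj_onI, clarify)
      fix k l :: 'a and v w
      assume v: "v \<in> vec.span B" and w: "w \<in> vec.span B" and eq: "k *s b + v = l *s b + w"
      have "k = l"
      proof (rule ccontr)
        assume "k \<noteq> l"
        have "(k - l) *s b = w - v"
          using eq by (simp add: vec.scale_left_diff_distrib algebra_simps)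
        then have "(k - l) *s b \<in> vec.span B"
          using v w by (simp add: vec.span_diff)
        then have "inverse (k - l) *s ((k - l) *s b) \<in> vec.span B" by (rule vec.span_scale)
        then show False
          using b \<open>k \<noteq> l\<close> unfolding vec.scale_scale by simp
      qed
      then show "k = l \<and> v = w" using eq by simp
    qed
    have "?h ` (UNIV \<times> vec.span B) = vec.span (insert b B)"
    proof (intro equalityI subsetI)
      fix x assume "x \<in> ?h ` (UNIV \<times> vec.span B)"
      then show "x \<in> vec.span (insert b B)"
        by (auto simp: vec.span_breakdown_eq) (metis add_diff_cancel_left')
    next
      fix x assume "x \<in> vec.span (insert b B)"
      then obtain k where "x - k *s b \<in> vec.span B" by (auto simp: vec.span_breakdown_eq)
      then show "x \<in> ?h ` (UNIV \<times> vec.span B)"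
        by (intro image_eqI[where x = "(k, x - k *s b)"]) auto
    qed
    then have "card (vec.span (insert b B)) = card ((UNIV :: 'a set) \<times> vec.span B)"
      using card_image[OF inj] by simp
    then show ?case
      using insert ind by (simp add: card_cartesian_product)
  qed
  then show ?thesis
    using vec.basis_subspace_exists[OF assms] by metis
qed

lemma span_insert_subset_iff:
  fixes S :: "('a::field ^ 'n) set"
  assumes "vec.subspace W"
  shows "vec.span (insert x S) \<subseteq> W \<longleftrightarrow> x \<in> W \<and> S \<subseteq> W"
proof
  assume "vec.span (insert x S) \<subseteq> W"
  with vec.span_superset[of "insert x S"] have "insert x S \<subseteq> W" by (rule order_trans)
  then show "x \<in> W \<and> S \<subseteq> W" by simp
next
  assume "x \<in> W \<and> S \<subseteq> W"
  then show "vec.span (insert x S) \<subseteq> W" using assms by (intro vec.span_minimal) auto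
qed

lemma dim_span_insert:
  fixes S :: "('a::field ^ 'n) set"
  assumes "vec.subspace S" "x \<notin> S"
  shows "vec.dim (vec.span (insert x S)) = Suc (vec.dim S)"
proof -
  have "x \<notin> vec.span S" using assms by (metis vec.span_eq_iff)
  then show ?thesis by (simp add: vec.dim_insert)
qed

lemma subspace_between:
  fixes T U :: "('a::field ^ 'n) set"
  assumes "vec.subspace T" "vec.subspace U" "T \<subseteq> U" "vec.dim T \<le> k" "k \<le> vec.dim U"
  obtains W where "vec.subspace W" "T \<subseteq> W" "W \<subseteq> U" "vec.dim W = k"
proof -
  have "\<exists>W. vec.subspace W \<and> T \<subseteq> W \<and> W \<subseteq> U \<and> vec.dim W = k"
    using assms(4,5)
  proof (induction k rule: dec_induct)
    case base
    then show ?case using assms by blast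
  next
    case (step k)
    then obtain W where W: "vec.subspace W" "T \<subseteq> W" "W \<subseteq> U" "vec.dim W = k" by auto
    then obtain x where x: "x \<in> U" "x \<notin> W"
      using step.prems by (metis Suc_n_not_le_n subsetI vec.dim_subset dual_order.trans)
    show ?case
    proof (intro exI conjI)
      show "vec.dim (vec.span (insert x W)) = Suc k"
        using W x by (simp add: dim_span_insert del: vec.dim_span)
      show "vec.span (insert x W) \<subseteq> U"
        using W x assms by (simp add: span_insert_subset_iff)
      show "T \<subseteq> vec.span (insert x W)"
        using W by (meson subset_insertI subset_trans vec.span_superset)
    qed simp
  qed
  then show thesis using that by blast
qed

text \<open>Greedy choice: while \<open>C\<close> is too small, the sum of
  \<open>S \<inter> G\<close> and \<open>C\<close> has smaller dimension than \<open>G\<close>, and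
  any vector of \<open>G\<close> outside that sum can be added to \<open>C\<close>.\<close>

lemma subspace_avoiding:
  fixes S G :: "('a::field ^ 'n) set"
  assumes S: "vec.subspace S" and G: "vec.subspace G" and "vec.dim (S \<inter> G) + k \<le> vec.dim G"
  obtains C where "vec.subspace C" "C \<subseteq> G" "vec.dim C = k" "S \<inter> C \<subseteq> {0}"
proof -
  have "\<exists>C. vec.subspace C \<and> C \<subseteq> G \<and> vec.dim C = k \<and> S \<inter> C \<subseteq> {0}"
    using assms(3)
  proof (induction k)
    case 0
    show ?case by (rule exI[of _ "{0}"]) (use G in \<open>auto simp: vec.subspace_0\<close>)
  next
    case (Suc k)
    then obtain C where C: "vec.subspace C" "C \<subseteq> G" "vec.dim C = k" "S \<inter> C \<subseteq> {0}" by auto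
    have SG: "vec.subspace (S \<inter> G)" using S G by (rule vec.subspace_inter)
    let ?D = "{x + y |x y. x \<in> S \<inter> G \<and> y \<in> C}"
    have "vec.dim ?D \<le> vec.dim (S \<inter> G) + k"
      using vec.dim_sums_Int[OF SG C(1)] C(3) by linarith
    then have "vec.dim ?D < vec.dim G" using Suc.prems by linarith
    then obtain x where x: "x \<in> G" "x \<notin> ?D"
      by (metis (no_types, lifting) leD subsetI vec.dim_subset)
    have x': "x \<notin> C"
      using x(2) SG by (force dest: vec.subspace_0)
    have zero: "y = 0" if yS: "y \<in> S" and y: "y \<in> vec.span (insert x C)" for y
    proof -
      obtain a where a: "y - a *s x \<in> C"
        using y C(1) by (auto simp: vec.span_breakdown_eq vec.span_eq_iff[THEN iffD2])
      have "vec.span (insert x C) \<subseteq> G"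
        using C x G by (simp add: span_insert_subset_iff)
      then have yG: "y \<in> S \<inter> G" using y yS by blast
      \<comment> \<open>With \<open>a\<close> nonzero, solving for \<open>x\<close> would put it
        into the sum \<open>?D\<close>.\<close>
      have "a = 0"
      proof (rule ccontr)
        assume "a \<noteq> 0"
        have "inverse a *s y \<in> S \<inter> G" using SG yG by (rule vec.subspace_scale)
        moreover have "(- inverse a) *s (y - a *s x) \<in> C" using C(1) a by (rule vec.subspace_scale)
        moreover have "x = inverse a *s y + (- inverse a) *s (y - a *s x)"
          using \<open>a \<noteq> 0\<close> by (simp add: vec.scale_right_diff_distrib)
        ultimately show False using x(2) by blast
      qed
      then show "y = 0" using a yS C(4) by auto
    qed
    show ?case
    proof (intro exI conjI)
      show "vec.dim (vec.span (insert x C)) = Suc k"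
        using C x' by (simp add: dim_span_insert del: vec.dim_span)
      show "vec.span (insert x C) \<subseteq> G"
        using C x G by (simp add: span_insert_subset_iff)
      show "S \<inter> vec.span (insert x C) \<subseteq> {0}" using zero by blast
    qed simp
  qed
  then show thesis using that by blast
qed

lemma dim_Int_ge:
  fixes A B G :: "('a::field ^ 'n) set"
  assumes "vec.subspace A" "vec.subspace B" "vec.subspace G" "A \<subseteq> G" "B \<subseteq> G"
  shows "vec.dim A + vec.dim B \<le> vec.dim (A \<inter> B) + vec.dim G"
proof -
  have "{x + y |x y. x \<in> A \<and> y \<in> B} \<subseteq> G"
    using assms by (auto intro: vec.subspace_add)
  then have "vec.dim {x + y |x y. x \<in> A \<and> y \<in> B} \<le> vec.dim G" by (rule vec.dim_subset)
  then show ?thesis using vec.dim_sums_Int[OF assms(1,2)] by linarith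
qed

section \<open>Numerical estimates for the number of isotropic subspaces\<close>

text \<open>For an \<open>s\<close>-dimensional totally isotropic \<open>S\<close> this is the number of \<open>m\<close>-dimensional totally
  isotropic subspaces above \<open>S\<close> in dimension \<open>n\<close> over a field with \<open>q\<close> elements: the \<open>i\<close>-th factor
  counts the vectors extending an \<open>i\<close>-dimensional totally isotropic subspace, inside its orthogonal
  complement (numerator) and inside a fixed \<open>m\<close>-space (denominator).\<close>

definition iso_count :: "nat \<Rightarrow> nat \<Rightarrow> nat \<Rightarrow> nat \<Rightarrow> real" where
  "iso_count q n s m = (\<Prod>i=s..<m. (real q ^ (n - i) - real q ^ i) / (real q ^ m - real q ^ i))"

lemma iso_count_self [simp]: "iso_count q n m m = 1"
  by (simp add: iso_count_def)

lemma iso_count_rec: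
  "s < m \<Longrightarrow> iso_count q n s m = (real q ^ (n - s) - real q ^ s) / (real q ^ m - real q ^ s) * iso_count q n (Suc s) m"
  by (simp add: iso_count_def prod.atLeast_Suc_lessThan)

lemma iso_count_pos:
  assumes "2 \<le> q" "2 * m \<le> n"
  shows "0 < iso_count q n s m"
  unfolding iso_count_def
proof (intro prod_pos ballI divide_pos_pos)
  fix i assume "i \<in> {s..<m}"
  then show "0 < real q ^ (n - i) - real q ^ i" "0 < real q ^ m - real q ^ i"
    using assms by (auto intro!: power_strict_increasing)
qed

text \<open>Since \<open>s < m \<le> n - m\<close>, the term \<open>q ^ s\<close> in the numerator
  may be replaced by the larger \<open>q ^ (n - m)\<close>; the denominator then divides out and
  leaves a pure power.\<close>

lemma iso_count_ge_Suc:
  assumes "2 \<le> q" "2 * m \<le> n" "s < m"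
  shows "real q ^ (n - s - m) * iso_count q n (Suc s) m \<le> iso_count q n s m"
proof -
  have pos: "0 < real q ^ m - real q ^ s"
    using assms by (auto intro!: power_strict_increasing)
  have "real q ^ (n - s - m) * (real q ^ m - real q ^ s) = real q ^ (n - s) - real q ^ (n - m)"
    using assms by (simp add: right_diff_distrib flip: power_add)
  also have "\<dots> \<le> real q ^ (n - s) - real q ^ s"
    using assms by (auto intro!: power_increasing)
  finally have "real q ^ (n - s - m) \<le> (real q ^ (n - s) - real q ^ s) / (real q ^ m - real q ^ s)"
    using pos by (simp add: pos_le_divide_eq)
  then show ?thesis
    unfolding iso_count_rec[OF assms(3)]
    using iso_count_pos[OF assms(1,2), of "Suc s"] by (intro mult_right_mono) auto
qed

text \<open>Iterates the one-level estimate: at level \<open>s\<close> its exponent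
  \<open>n - s - m\<close> is at least \<open>m' + 1 + (\<tau> - s)\<close>. The index
  \<open>i\<close> is the distance to \<open>\<tau>\<close>, so that the powers pair up with those
  from counting hyperplanes.\<close>

lemma iso_count_ge_prod:
  assumes "2 \<le> q" "2 * m \<le> n" "m + m' + 1 + \<tau> \<le> n" "s \<le> \<tau>" "\<tau> \<le> m"
  shows "(\<Prod>i=1..\<tau> - s. real q ^ (m' + 1 + i)) * iso_count q n \<tau> m \<le> iso_count q n s m"
  using assms(4)
proof (induction s rule: inc_induct)
  case base
  then show ?case by simp
next
  case (step s)
  have "\<tau> - s = Suc (\<tau> - Suc s)" using step by simp
  then have "(\<Prod>i=1..\<tau> - s. real q ^ (m' + 1 + i)) * iso_count q n \<tau> m
      = real q ^ (m' + 1 + (\<tau> - s)) * ((\<Prod>i=1..\<tau> - Suc s. real q ^ (m' + 1 + i)) * iso_count q n \<tau> m)"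
    by simp
  also have "\<dots> \<le> real q ^ (m' + 1 + (\<tau> - s)) * iso_count q n (Suc s) m"
    using step.IH by (intro mult_left_mono) auto
  also have "\<dots> \<le> real q ^ (n - s - m) * iso_count q n (Suc s) m"
    using assms(1,3) step.hyps iso_count_pos[OF assms(1,2), of "Suc s"]
    by (intro mult_right_mono power_increasing) auto
  also have "\<dots> \<le> iso_count q n s m"
    using assms(1,2,5) step.hyps by (intro iso_count_ge_Suc) auto
  finally show ?case .
qed

text \<open>The hypothesis \<open>m + m' + 1 + \<tau> \<le> n\<close> is what the theorem's dimension bound provides for
  either family; it makes each of the \<open>\<tau> - t\<close> steps gain \<open>q ^ (m' + 1 + i)\<close>, which pays exactly for
  one hyperplane choice \<open>q ^ (t + i)\<close> and one extension choice \<open>q ^ (m' - t + 1)\<close>.\<close>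
lemma cover_bound_le_iso_count:
  assumes "2 \<le> q" "2 * m \<le> n" "m + m' + 1 + \<tau> \<le> n" "t \<le> \<tau>" "\<tau> \<le> m" "t \<le> m'"
  defines "bound \<equiv> (\<Prod>i=1..\<tau> - t. real q ^ (t + i)) * ((real q ^ (m' - t + 1) - 1) ^ (\<tau> - t) * iso_count q n \<tau> m)"
  shows "bound \<le> iso_count q n t m"
    and "t < \<tau> \<Longrightarrow> bound < iso_count q n t m"
proof -
  let ?Q = "real q ^ (m' - t + 1)" and ?h = "\<Prod>i=1..\<tau> - t. real q ^ (t + i)"
  have N: "0 < iso_count q n \<tau> m" using assms(1,2) by (rule iso_count_pos)
  have h: "0 < ?h" using assms(1) by (intro prod_pos) auto
  have Q: "1 \<le> ?Q" using assms(1) by (intro one_le_power) auto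
  have "?h * ?Q ^ (\<tau> - t) = (\<Prod>i=1..\<tau> - t. real q ^ (t + i) * ?Q)"
    by (simp add: prod.distrib)
  also have "\<dots> = (\<Prod>i=1..\<tau> - t. real q ^ (m' + 1 + i))"
  proof (rule prod.cong)
    fix i
    have "t + i + (m' - t + 1) = m' + 1 + i" using assms(6) by simp
    then show "real q ^ (t + i) * ?Q = real q ^ (m' + 1 + i)" by (metis power_add)
  qed simp
  finally have le: "?h * (?Q ^ (\<tau> - t) * iso_count q n \<tau> m) \<le> iso_count q n t m"
    using iso_count_ge_prod[OF assms(1-5)] by (simp flip: mult.assoc)
  have "(?Q - 1) ^ (\<tau> - t) \<le> ?Q ^ (\<tau> - t)" using Q by (intro power_mono) auto
  then have "bound \<le> ?h * (?Q ^ (\<tau> - t) * iso_count q n \<tau> m)"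
    unfolding bound_def using h N by (intro mult_left_mono mult_right_mono) auto
  with le show "bound \<le> iso_count q n t m" by linarith
  show "bound < iso_count q n t m" if "t < \<tau>"
  proof -
    \<comment> \<open>The strict inequality comes from \<open>?Q - 1 < ?Q\<close>, which needs a
      positive exponent.\<close>
    have "(?Q - 1) ^ (\<tau> - t) < ?Q ^ (\<tau> - t)" using Q that by (intro power_strict_mono) auto
    then have "bound < ?h * (?Q ^ (\<tau> - t) * iso_count q n \<tau> m)"
      unfolding bound_def using h N by (intro mult_strict_left_mono mult_strict_right_mono) auto
    with le show ?thesis by linarith
  qed
qed

section \<open>Orthogonal complements of a symplectic form\<close>

definition perp :: "('a::field ^ 'n \<Rightarrow> 'a ^ 'n \<Rightarrow> 'a) \<Rightarrow> ('a ^ 'n) set \<Rightarrow> ('a ^ 'n) set" where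
  "perp f S = {x. \<forall>y\<in>S. f x y = 0}"

locale symplectic_form =
  fixes f :: "'a::{field,finite} ^ 'n::finite \<Rightarrow> 'a ^ 'n \<Rightarrow> 'a"
  assumes bilin: "bilinear_form f" and alt: "alternating_form f" and nondeg: "nondegenerate_form f"
begin

lemma add_left: "f (x + y) z = f x z + f y z"
  and add_right: "f x (y + z) = f x y + f x z"
  and scale_left: "f (c *s x) y = c * f x y"
  and scale_right: "f x (c *s y) = c * f x y"
  using bilin unfolding bilinear_form_def by blast+

lemma self_zero [simp]: "f x x = 0"
  using alt unfolding alternating_form_def by blast

lemma zero_left [simp]: "f 0 y = 0" and zero_right [simp]: "f x 0 = 0"
  using scale_left[of 0 0 y] scale_right[of x 0 0] by auto

lemma skew: "f x y = - f y x"
proof -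
  have "f (x + y) (x + y) = 0" by simp
  then show ?thesis by (simp add: add_left add_right add_eq_0_iff2 del: self_zero) (simp add: add_eq_0_iff2)
qed

lemma subspace_perp [simp]: "vec.subspace (perp f S)"
  by (auto simp: vec.subspace_def perp_def add_left scale_left)

lemma subspace_kernel: "vec.subspace {y. f y x = 0}" "vec.subspace {y. f x y = 0}"
  by (auto simp: vec.subspace_def add_left scale_left add_right scale_right)

lemma perp_span: "perp f (vec.span S) = perp f S"
proof
  show "perp f (vec.span S) \<subseteq> perp f S"
    using vec.span_superset by (auto simp: perp_def)
  show "perp f S \<subseteq> perp f (vec.span S)"
  proof
    fix x assume "x \<in> perp f S"
    then have "S \<subseteq> {y. f x y = 0}" by (auto simp: perp_def)
    then have "vec.span S \<subseteq> {y. f x y = 0}"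
      by (rule vec.span_minimal) (rule subspace_kernel)
    then show "x \<in> perp f (vec.span S)" by (auto simp: perp_def)
  qed
qed

lemma dim_le_Suc_dim_kernel:
  assumes "vec.subspace W"
  shows "vec.dim W \<le> Suc (vec.dim (W \<inter> {y. f y x = 0}))"
proof (cases "W \<subseteq> {y. f y x = 0}")
  case True
  then show ?thesis by (simp add: Int_absorb2)
next
  case False
  then obtain w where w: "w \<in> W" "f w x \<noteq> 0" by auto
  define K where "K = W \<inter> {y. f y x = 0}"
  \<comment> \<open>Subtracting a suitable multiple of \<open>w\<close> moves any \<open>y\<close>
    into the kernel, so \<open>w\<close> is the only direction lost.\<close>
  have "W \<subseteq> vec.span (insert w K)"
  proof
    fix y assume "y \<in> W"
    then have "y - (f y x / f w x) *s w \<in> W"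
      using w assms by (intro vec.subspace_diff vec.subspace_scale)
    moreover have "f y x = f (y - (f y x / f w x) *s w) x + (f y x / f w x) * f w x"
      by (simp flip: add_left scale_left)
    ultimately have "y - (f y x / f w x) *s w \<in> K"
      using w by (simp add: K_def)
    then show "y \<in> vec.span (insert w K)"
      unfolding vec.span_breakdown_eq using vec.span_base by blast
  qed
  then have "vec.dim W \<le> vec.dim (insert w K)" by (rule vec.dim_mono)
  also have "\<dots> \<le> Suc (vec.dim K)" by (simp add: vec.dim_insert)
  finally show ?thesis unfolding K_def .
qed

text \<open>Each vector added to \<open>S\<close> imposes one linear condition on the complement,
  which costs at most one dimension while \<open>S\<close> gains one.\<close>

lemma dim_perp_add_dim_mono:
  assumes "vec.subspace S" "vec.subspace U" "S \<subseteq> U"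
  shows "vec.dim (perp f S) + vec.dim S \<le> vec.dim (perp f U) + vec.dim U"
  using assms
proof (induction "vec.dim U - vec.dim S" arbitrary: S)
  case 0
  then have "S = U" by (metis diff_is_0_eq vec.subspace_dim_equal)
  then show ?case by simp
next
  case (Suc k)
  then obtain x where x: "x \<in> U" "x \<notin> S" by (metis diff_self_eq_0 nat.distinct(1) subsetI subset_antisym)
  let ?S = "vec.span (insert x S)"
  have d: "vec.dim ?S = Suc (vec.dim S)" using Suc.prems x by (simp add: dim_span_insert del: vec.dim_span)
  have "k = vec.dim U - vec.dim ?S" using Suc.hyps(2) d by simp
  moreover have "?S \<subseteq> U" using Suc.prems x by (simp add: span_insert_subset_iff)
  ultimately have IH: "vec.dim (perp f ?S) + vec.dim ?S \<le> vec.dim (perp f U) + vec.dim U"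
    using Suc.hyps(1)[of ?S] Suc.prems(2) vec.subspace_span by blast
  have "perp f ?S = perp f S \<inter> {y. f y x = 0}"
    unfolding perp_span by (auto simp: perp_def)
  then have "vec.dim (perp f S) \<le> Suc (vec.dim (perp f ?S))"
    using dim_le_Suc_dim_kernel[OF subspace_perp] by simp
  then show ?case using IH d by linarith
qed

lemma dim_perp:
  assumes "vec.subspace S"
  shows "vec.dim (perp f S) + vec.dim S = CARD('n)"
proof (rule antisym)
  \<comment> \<open>Nondegeneracy enters here. The sum equals \<open>CARD('n)\<close> both for
    \<open>UNIV\<close> and for \<open>{0}\<close>, and monotonicity squeezes every \<open>S\<close>
    in between.\<close>
  have "perp f UNIV = {0}" using nondeg by (auto simp: perp_def nondegenerate_form_def)
  then show "vec.dim (perp f S) + vec.dim S \<le> CARD('n)"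
    using dim_perp_add_dim_mono[OF assms vec.subspace_UNIV] by (simp only: vec_dim_card) simp
  have "perp f {0} = UNIV" by (auto simp: perp_def)
  then show "CARD('n) \<le> vec.dim (perp f S) + vec.dim S"
    using dim_perp_add_dim_mono[of "{0}" S] assms vec.subspace_0[OF assms] by (simp only: vec_dim_card) simp
qed

section \<open>Counting subspaces of a given subspace\<close>

text \<open>A hyperplane of \<open>S\<close> is the zero set in \<open>S\<close> of some functional
  \<open>f x\<close>. Only \<open>x\<close> modulo \<open>perp f S\<close> matters, so
  \<open>x\<close> can be drawn from a complement of \<open>perp f S\<close>, which has dimension
  \<open>vec.dim S\<close>.\<close>

lemma card_hyperplanes_le:
  fixes S :: "('a ^ 'n) set"
  assumes S: "vec.subspace S"
  shows "card {H. vec.subspace H \<and> H \<subseteq> S \<and> Suc (vec.dim H) = vec.dim S} \<le> CARD('a) ^ vec.dim S"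
proof -
  have "vec.dim (perp f S \<inter> UNIV) + vec.dim S \<le> vec.dim (UNIV :: ('a^'n) set)"
    using dim_perp[OF S] unfolding vec_dim_card by simp
  then obtain C where C: "vec.subspace C" "vec.dim C = vec.dim S" "perp f S \<inter> C \<subseteq> {0}"
    using subspace_avoiding[OF subspace_perp vec.subspace_UNIV] by metis
  let ?D = "{x + y |x y. x \<in> perp f S \<and> y \<in> C}"
  have "?D = UNIV"
  proof (rule vec.subspace_dim_equal)
    have "vec.dim (perp f S \<inter> C) = 0" using C by simp
    then show "vec.dim (UNIV :: ('a ^ 'n) set) \<le> vec.dim ?D"
      using vec.dim_sums_Int[OF subspace_perp C(1), of S] dim_perp[OF S] C(2) unfolding vec_dim_card by linarith
  qed (auto intro: vec.subspace_sums C)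
  have "{H. vec.subspace H \<and> H \<subseteq> S \<and> Suc (vec.dim H) = vec.dim S} \<subseteq> (\<lambda>x. S \<inter> {y. f x y = 0}) ` C"
  proof clarify
    fix H assume H: "vec.subspace H" "H \<subseteq> S" "Suc (vec.dim H) = vec.dim S"
    \<comment> \<open>\<open>H\<close> is smaller than \<open>S\<close>, so its complement is
      larger: some \<open>x\<close> annihilates \<open>H\<close> but not \<open>S\<close>.\<close>
    have "vec.dim (perp f S) < vec.dim (perp f H)"
      using dim_perp[OF S] dim_perp[OF H(1)] H(3) by linarith
    then obtain x where x: "x \<in> perp f H" "x \<notin> perp f S"
      using vec.dim_subset by (metis leD subsetI)
    obtain p c where c: "x = p + c" "p \<in> perp f S" "c \<in> C" using \<open>?D = UNIV\<close> by blast
    have "S \<inter> {y. f c y = 0} = S \<inter> {y. f x y = 0}"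
      using c by (auto simp: perp_def add_left)
    moreover have "H = S \<inter> {y. f x y = 0}"
    proof (rule vec.subspace_dim_equal[OF H(1)])
      show sub: "vec.subspace (S \<inter> {y. f x y = 0})" using S subspace_kernel(2) by (rule vec.subspace_inter)
      show "H \<subseteq> S \<inter> {y. f x y = 0}" using x(1) H(2) by (auto simp: perp_def)
      have "S \<inter> {y. f x y = 0} \<noteq> S" using x(2) by (auto simp: perp_def)
      then have "vec.dim (S \<inter> {y. f x y = 0}) < vec.dim S"
        using vec.subspace_dim_equal[OF sub S] by (meson Int_lower1 not_le)
      then show "vec.dim (S \<inter> {y. f x y = 0}) \<le> vec.dim H" using H(3) by linarith
    qed
    ultimately show "H \<in> (\<lambda>x. S \<inter> {y. f x y = 0}) ` C" using c(3) by blast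
  qed
  then have "card {H. vec.subspace H \<and> H \<subseteq> S \<and> Suc (vec.dim H) = vec.dim S} \<le> card C"
    by (rule surj_card_le[OF finite])
  then show ?thesis using card_subspace[OF C(1)] C(2) by simp
qed

text \<open>Descends through hyperplanes one dimension at a time; the \<open>i\<close>-th factor
  bounds the hyperplanes of a space of dimension \<open>t + i\<close>.\<close>

lemma card_subspaces_of_subspace_le:
  fixes S :: "('a ^ 'n) set"
  assumes "vec.subspace S" "vec.dim S = k + t"
  shows "card {T. vec.subspace T \<and> T \<subseteq> S \<and> vec.dim T = t} \<le> (\<Prod>i=1..k. CARD('a) ^ (t + i))"
  using assms
proof (induction k arbitrary: S)
  case 0
  have "{T. vec.subspace T \<and> T \<subseteq> S \<and> vec.dim T = t} \<subseteq> {S}"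
    using 0 by (auto dest: vec.subspace_dim_equal)
  then show ?case using card_mono[of "{S}"] by force
next
  case (Suc k)
  let ?H = "{H. vec.subspace H \<and> H \<subseteq> S \<and> Suc (vec.dim H) = vec.dim S}"
  let ?T = "\<lambda>S. {T. vec.subspace T \<and> T \<subseteq> S \<and> vec.dim T = t}"
  have "?T S \<subseteq> (\<Union>H\<in>?H. ?T H)"
  proof
    fix T assume "T \<in> ?T S"
    then have T: "vec.subspace T" "T \<subseteq> S" "vec.dim T = t" by auto
    obtain H where "vec.subspace H" "T \<subseteq> H" "H \<subseteq> S" "vec.dim H = k + t"
      using subspace_between[of T S "k + t"] T Suc.prems by auto
    then show "T \<in> (\<Union>H\<in>?H. ?T H)" using T Suc.prems by auto
  qed
  then have "card (?T S) \<le> card (\<Union>H\<in>?H. ?T H)" by (simp add: card_mono)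
  also have "\<dots> \<le> (\<Sum>H\<in>?H. card (?T H))" by (rule card_UN_le) simp
  also have "\<dots> \<le> (\<Sum>H\<in>?H. \<Prod>i=1..k. CARD('a) ^ (t + i))"
    using Suc by (intro sum_mono) auto
  also have "\<dots> = card ?H * (\<Prod>i=1..k. CARD('a) ^ (t + i))" by simp
  also have "\<dots> \<le> CARD('a) ^ (t + Suc k) * (\<Prod>i=1..k. CARD('a) ^ (t + i))"
    using card_hyperplanes_le[OF Suc.prems(1)] Suc.prems(2) by (intro mult_right_mono) (simp_all add: add.commute)
  also have "\<dots> = (\<Prod>i=1..Suc k. CARD('a) ^ (t + i))"
    by (simp add: mult.commute)
  finally show ?case .
qed

section \<open>Counting totally isotropic subspaces above a given one\<close>

lemma two_le_CARD: "2 \<le> CARD('a)"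
proof -
  have "card {0 :: 'a, 1} \<le> CARD('a)" by (rule card_mono) auto
  then show ?thesis by simp
qed

lemma one_le_CARD_power: "1 \<le> real CARD('a) ^ k"
  using two_le_CARD by (intro one_le_power) simp

lemma iso_subspacesD:
  assumes "S \<in> iso_subspaces f s"
  shows "vec.subspace S" "vec.dim S = s" "S \<subseteq> perp f S"
  using assms by (auto simp: iso_subspaces_def totally_isotropic_def perp_def)

text \<open>As \<open>f x x = 0\<close>, orthogonality to \<open>S\<close> is the only condition on
  a new vector.\<close>

lemma span_insert_in_iso_subspaces_iff:
  assumes S: "S \<in> iso_subspaces f s" and x: "x \<notin> S"
  shows "vec.span (insert x S) \<in> iso_subspaces f (Suc s) \<longleftrightarrow> x \<in> perp f S"
proof
  assume "vec.span (insert x S) \<in> iso_subspaces f (Suc s)"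
  then have "vec.span (insert x S) \<subseteq> perp f (insert x S)"
    using iso_subspacesD(3) perp_span by metis
  then have "x \<in> perp f (insert x S)" using vec.span_base by blast
  then show "x \<in> perp f S" by (simp add: perp_def)
next
  assume xS: "x \<in> perp f S"
  have "insert x S \<subseteq> perp f (insert x S)"
  proof
    fix y assume "y \<in> insert x S"
    moreover have "f y x = 0" if "y \<in> S"
      using xS that skew[of y x] by (simp add: perp_def)
    ultimately show "y \<in> perp f (insert x S)"
      using xS iso_subspacesD(3)[OF S] by (auto simp: perp_def)
  qed
  then have "vec.span (insert x S) \<subseteq> perp f (vec.span (insert x S))"
    unfolding perp_span using subspace_perp by (intro vec.span_minimal)
  then show "vec.span (insert x S) \<in> iso_subspaces f (Suc s)"
    unfolding iso_subspaces_def totally_isotropic_def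
    using dim_span_insert[OF iso_subspacesD(1)[OF S] x] iso_subspacesD(2)[OF S]
    by (auto simp: perp_def simp del: vec.dim_span)
qed

text \<open>Double counting of pairs of a member \<open>F\<close> above \<open>S\<close> and a
  vector \<open>x\<close> of \<open>F - S\<close>. Each \<open>F\<close> has
  \<open>q ^ m - q ^ s\<close> such vectors; for \<open>x\<close> in \<open>perp f S - S\<close>,
  the members through \<open>x\<close> are those above an isotropic space of dimension
  \<open>Suc s\<close>, counted by induction.\<close>

lemma card_iso_subspaces_above:
  assumes "S \<in> iso_subspaces f s" "s \<le> m"
  shows "real (card {F \<in> iso_subspaces f m. S \<subseteq> F}) = iso_count CARD('a) CARD('n) s m"
  using assms(2,1)
proof (induction s arbitrary: S rule: inc_induct)
  case base
  have "F = S" if "F \<in> iso_subspaces f m" "S \<subseteq> F" for F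
    by (rule vec.subspace_dim_equal[symmetric]) (use base that in \<open>simp_all add: iso_subspacesD\<close>)
  with base have "{F \<in> iso_subspaces f m. S \<subseteq> F} = {S}" by blast
  then show ?case by simp
next
  case (step s)
  let ?q = "CARD('a)"
  define \<A> where "\<A> = {F \<in> iso_subspaces f m. S \<subseteq> F}"
  have S: "vec.subspace S" "vec.dim S = s" "S \<subseteq> perp f S" using step.prems by (auto dest: iso_subspacesD)
  have perp: "vec.dim (perp f S) = CARD('n) - s" using dim_perp[OF S(1)] S(2) by linarith
  have cardF: "real (card (F - S)) = real ?q ^ m - real ?q ^ s" if F: "F \<in> \<A>" for F
  proof -
    have "card (F - S) = ?q ^ m - ?q ^ s"
      using F S by (subst card_Diff_subset) (auto simp: \<A>_def card_subspace iso_subspacesD)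
    moreover have "?q ^ s \<le> ?q ^ m" using step.hyps by (intro power_increasing) auto
    ultimately show ?thesis by (simp add: of_nat_diff)
  qed
  have cardP: "real (card (perp f S - S)) = real ?q ^ (CARD('n) - s) - real ?q ^ s"
  proof -
    have "card (perp f S - S) = ?q ^ (CARD('n) - s) - ?q ^ s"
      using S perp by (subst card_Diff_subset) (auto simp: card_subspace)
    moreover have "card S \<le> card (perp f S)" using S(3) by (intro card_mono) auto
    ultimately show ?thesis using S perp by (simp add: of_nat_diff card_subspace)
  qed
  have sub: "F - S = {x \<in> perp f S - S. x \<in> F}" if "F \<in> \<A>" for F
    using that iso_subspacesD(3)[of F m] by (auto simp: \<A>_def perp_def)
  have above: "real (card {F \<in> \<A>. x \<in> F}) = iso_count ?q CARD('n) (Suc s) m" if x: "x \<in> perp f S - S" for x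
  proof -
    have "{F \<in> \<A>. x \<in> F} = {F \<in> iso_subspaces f m. vec.span (insert x S) \<subseteq> F}"
      using span_insert_subset_iff[OF iso_subspacesD(1)] unfolding \<A>_def by blast
    then show ?thesis
      using step.IH[of "vec.span (insert x S)"] span_insert_in_iso_subspaces_iff[OF step.prems, of x] x by simp
  qed
  have "(real ?q ^ m - real ?q ^ s) * real (card \<A>) = (\<Sum>F\<in>\<A>. real (card (F - S)))"
    using cardF by simp
  also have "\<dots> = (\<Sum>F\<in>\<A>. \<Sum>x\<in>perp f S - S. if x \<in> F then 1 else 0)"
    by (intro sum.cong refl) (simp only: sub, simp add: sum.If_cases Int_def)
  also have "\<dots> = (\<Sum>x\<in>perp f S - S. \<Sum>F\<in>\<A>. if x \<in> F then 1 else 0)"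
    by (rule sum.swap)
  also have "\<dots> = (\<Sum>x\<in>perp f S - S. real (card {F \<in> \<A>. x \<in> F}))"
    by (intro sum.cong refl) (simp add: sum.If_cases Int_def)
  also have "\<dots> = (real ?q ^ (CARD('n) - s) - real ?q ^ s) * iso_count ?q CARD('n) (Suc s) m"
    using above cardP by simp
  finally have "(real ?q ^ m - real ?q ^ s) * real (card \<A>)
      = (real ?q ^ (CARD('n) - s) - real ?q ^ s) * iso_count ?q CARD('n) (Suc s) m" .
  moreover have "real ?q ^ s < real ?q ^ m"
    using step.hyps two_le_CARD by (intro power_strict_increasing) auto
  ultimately show ?case
    unfolding \<A>_def[symmetric] iso_count_rec[OF step.hyps(2)] by (simp add: field_simps)
qed

section \<open>Bounding a cross intersecting family by covers\<close>

text \<open>Every member above \<open>S\<close> meets \<open>G\<close> in dimension at least \<open>t\<close>, hence meets a complementary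
  \<open>(m2 - t + 1)\<close>-space \<open>C \<le> G\<close> with \<open>C \<inter> S = 0\<close> in a nonzero vector, which enlarges \<open>S\<close>.\<close>
lemma card_above_le_step:
  assumes \<F>: "\<F> \<subseteq> iso_subspaces f m1" and G: "G \<in> iso_subspaces f m2"
    and meet: "\<And>A. A \<in> \<F> \<Longrightarrow> t \<le> vec.dim (A \<inter> G)"
    and S: "vec.subspace S" "vec.dim (S \<inter> G) < t" and "t \<le> m2"
    and M: "\<And>R. vec.subspace R \<Longrightarrow> vec.dim R = Suc (vec.dim S) \<Longrightarrow> real (card {A \<in> \<F>. R \<subseteq> A}) \<le> M"
  shows "real (card {A \<in> \<F>. S \<subseteq> A}) \<le> (real CARD('a) ^ (m2 - t + 1) - 1) * M"
proof -
  have G': "vec.subspace G" "vec.dim G = m2" using G by (auto dest: iso_subspacesD)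
  have "vec.dim (S \<inter> G) + (m2 - t + 1) \<le> vec.dim G" using S(2) G'(2) \<open>t \<le> m2\<close> by linarith
  then obtain C where C: "vec.subspace C" "C \<subseteq> G" "vec.dim C = m2 - t + 1" "S \<inter> C \<subseteq> {0}"
    by (rule subspace_avoiding[OF S(1) G'(1)])
  have notin: "x \<notin> S" if "x \<in> C - {0}" for x using that C(4) by blast
  have "{A \<in> \<F>. S \<subseteq> A} \<subseteq> (\<Union>x\<in>C - {0}. {A \<in> \<F>. vec.span (insert x S) \<subseteq> A})"
  proof
    fix A assume "A \<in> {A \<in> \<F>. S \<subseteq> A}"
    then have A: "A \<in> \<F>" "S \<subseteq> A" "vec.subspace A" using \<F> by (auto dest: iso_subspacesD)
    \<comment> \<open>Inside \<open>G\<close> the two dimensions add up to at least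
      \<open>t + (m2 - t + 1) = m2 + 1\<close>, one more than \<open>vec.dim G\<close>.\<close>
    have "vec.dim (A \<inter> G) + vec.dim C \<le> vec.dim (A \<inter> G \<inter> C) + vec.dim G"
      using A(3) G'(1) C(1,2) by (intro dim_Int_ge vec.subspace_inter) auto
    then have "vec.dim (A \<inter> G \<inter> C) \<noteq> 0"
      using meet[OF A(1)] C(3) G'(2) \<open>t \<le> m2\<close> by linarith
    then obtain x where "x \<in> A" "x \<in> C - {0}" by auto
    then show "A \<in> (\<Union>x\<in>C - {0}. {A \<in> \<F>. vec.span (insert x S) \<subseteq> A})"
      using A by (auto simp: span_insert_subset_iff)
  qed
  then have "card {A \<in> \<F>. S \<subseteq> A} \<le> card (\<Union>x\<in>C - {0}. {A \<in> \<F>. vec.span (insert x S) \<subseteq> A})"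
    by (intro card_mono) auto
  also have "\<dots> \<le> (\<Sum>x\<in>C - {0}. card {A \<in> \<F>. vec.span (insert x S) \<subseteq> A})"
    by (rule card_UN_le) simp
  finally have "real (card {A \<in> \<F>. S \<subseteq> A}) \<le> (\<Sum>x\<in>C - {0}. real (card {A \<in> \<F>. vec.span (insert x S) \<subseteq> A}))"
    by (simp flip: of_nat_sum)
  also have "\<dots> \<le> (\<Sum>x\<in>C - {0}. M)"
    using notin dim_span_insert[OF S(1)] by (intro sum_mono M) auto
  \<comment> \<open>The \<open>- 1\<close> discards the zero vector; the later strict comparisons
    rest on it.\<close>
  also have "\<dots> = (real CARD('a) ^ (m2 - t + 1) - 1) * M"
    using card_subspace[OF C(1)] C(3) vec.subspace_0[OF C(1)] by (simp add: of_nat_diff card_Diff_singleton)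
  finally show ?thesis .
qed

text \<open>While \<open>vec.dim S < \<tau>\<close>, \<open>least\<close> yields a member of
  \<open>\<G>\<close> over which the extension step applies. After \<open>\<tau> - vec.dim S\<close>
  steps the exact count above a space of dimension \<open>\<tau>\<close> takes over.\<close>

lemma card_above_le_cover:
  assumes \<F>: "\<F> \<subseteq> iso_subspaces f m1" and \<G>: "\<G> \<subseteq> iso_subspaces f m2"
    and cross: "cross_t_intersecting \<F> \<G> t" and "t \<le> m2" and "\<tau> \<le> m1"
    and least: "\<And>S. vec.subspace S \<Longrightarrow> vec.dim S < \<tau> \<Longrightarrow> \<exists>G\<in>\<G>. vec.dim (S \<inter> G) < t"
    and S: "vec.subspace S" "vec.dim S \<le> \<tau>" and dim: "2 * m1 \<le> CARD('n)"
  shows "real (card {A \<in> \<F>. S \<subseteq> A})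
    \<le> (real CARD('a) ^ (m2 - t + 1) - 1) ^ (\<tau> - vec.dim S) * iso_count CARD('a) CARD('n) \<tau> m1"
  using S
proof (induction "\<tau> - vec.dim S" arbitrary: S)
  case 0
  then have d: "vec.dim S = \<tau>" by simp
  show ?case
  proof (cases "S \<in> iso_subspaces f \<tau>")
    case True
    have "card {A \<in> \<F>. S \<subseteq> A} \<le> card {A \<in> iso_subspaces f m1. S \<subseteq> A}"
      using \<F> by (intro card_mono) auto
    then show ?thesis
      using card_iso_subspaces_above[OF True \<open>\<tau> \<le> m1\<close>] d by simp
  next
    case False
    \<comment> \<open>Subspaces of isotropic members are isotropic, so a non-isotropic
      \<open>S\<close> lies in no member.\<close>
    then have none: "{A \<in> \<F>. S \<subseteq> A} = {}"
      using \<F> 0 d unfolding iso_subspaces_def totally_isotropic_def by blast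
    show ?thesis
      unfolding none using d iso_count_pos[OF two_le_CARD dim, of \<tau>] by simp
  qed
next
  case (Suc k)
  then have "vec.dim S < \<tau>" by linarith
  then obtain G where G: "G \<in> \<G>" "vec.dim (S \<inter> G) < t" using least Suc.prems(1) by blast
  have IH: "real (card {A \<in> \<F>. R \<subseteq> A}) \<le> (real CARD('a) ^ (m2 - t + 1) - 1) ^ k * iso_count CARD('a) CARD('n) \<tau> m1"
    if "vec.subspace R" "vec.dim R = Suc (vec.dim S)" for R
  proof -
    have "k = \<tau> - vec.dim R" "vec.dim R \<le> \<tau>" using that(2) Suc.hyps(2) by linarith+
    then show ?thesis using Suc.hyps(1)[of R] that(1) by simp
  qed
  have "real (card {A \<in> \<F>. S \<subseteq> A}) \<le> (real CARD('a) ^ (m2 - t + 1) - 1)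
      * ((real CARD('a) ^ (m2 - t + 1) - 1) ^ k * iso_count CARD('a) CARD('n) \<tau> m1)"
  proof (rule card_above_le_step[OF \<F>, of G])
    show "G \<in> iso_subspaces f m2" using G \<G> by blast
    show "t \<le> vec.dim (A \<inter> G)" if "A \<in> \<F>" for A
      using that G cross by (simp add: cross_t_intersecting_def)
  qed (use G Suc.prems IH \<open>t \<le> m2\<close> in auto)
  then show ?case unfolding Suc.hyps(2)[symmetric] by (simp add: mult.assoc)
qed

text \<open>Every member of \<open>\<F>\<close> contains a \<open>t\<close>-subspace of
  \<open>W\<close>; the bound sums over these. Two kinds of cover enter: \<open>W\<close> covers
  \<open>\<F>\<close>, while \<open>\<tau>\<close> is a lower bound for the dimension of covers of
  \<open>\<G>\<close>.\<close>

lemma card_le_covers: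
  assumes \<F>: "\<F> \<subseteq> iso_subspaces f m1" and \<G>: "\<G> \<subseteq> iso_subspaces f m2"
    and cross: "cross_t_intersecting \<F> \<G> t" and "t \<le> m2" and "t \<le> \<tau>" and "\<tau> \<le> m1"
    and least: "\<And>S. vec.subspace S \<Longrightarrow> vec.dim S < \<tau> \<Longrightarrow> \<exists>G\<in>\<G>. vec.dim (S \<inter> G) < t"
    and W: "vec.subspace W" "vec.dim W = \<sigma>" "\<And>A. A \<in> \<F> \<Longrightarrow> t \<le> vec.dim (W \<inter> A)"
    and "t \<le> \<sigma>" and dim: "2 * m1 \<le> CARD('n)"
  shows "real (card \<F>) \<le> (\<Prod>i=1..\<sigma> - t. real CARD('a) ^ (t + i))
    * ((real CARD('a) ^ (m2 - t + 1) - 1) ^ (\<tau> - t) * iso_count CARD('a) CARD('n) \<tau> m1)"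
proof -
  let ?T = "{T. vec.subspace T \<and> T \<subseteq> W \<and> vec.dim T = t}"
  define M where "M = (real CARD('a) ^ (m2 - t + 1) - 1) ^ (\<tau> - t) * iso_count CARD('a) CARD('n) \<tau> m1"
  have M: "0 \<le> M"
    unfolding M_def using iso_count_pos[OF two_le_CARD dim, of \<tau>] one_le_CARD_power
    by (intro mult_nonneg_nonneg zero_le_power) (auto simp del: power_Suc)
  have "\<F> \<subseteq> (\<Union>T\<in>?T. {A \<in> \<F>. T \<subseteq> A})"
  proof
    fix A assume A: "A \<in> \<F>"
    then have "vec.subspace (W \<inter> A)" using \<F> W(1) by (auto intro: vec.subspace_inter dest: iso_subspacesD)
    then obtain T where "vec.subspace T" "T \<subseteq> W \<inter> A" "vec.dim T = t"
      using W(3)[OF A] vec.choose_subspace_of_subspace[of t "W \<inter> A"] by (metis vec.span_eq_iff)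
    then show "A \<in> (\<Union>T\<in>?T. {A \<in> \<F>. T \<subseteq> A})" using A by blast
  qed
  then have "card \<F> \<le> card (\<Union>T\<in>?T. {A \<in> \<F>. T \<subseteq> A})" by (intro card_mono) auto
  also have "\<dots> \<le> (\<Sum>T\<in>?T. card {A \<in> \<F>. T \<subseteq> A})" by (rule card_UN_le) simp
  finally have "real (card \<F>) \<le> (\<Sum>T\<in>?T. real (card {A \<in> \<F>. T \<subseteq> A}))"
    by (simp flip: of_nat_sum)
  also have "\<dots> \<le> (\<Sum>T\<in>?T. M)"
  proof (rule sum_mono)
    fix T assume "T \<in> ?T"
    then show "real (card {A \<in> \<F>. T \<subseteq> A}) \<le> M"
      using card_above_le_cover[OF \<F> \<G> cross \<open>t \<le> m2\<close> \<open>\<tau> \<le> m1\<close> least, of T] \<open>t \<le> \<tau>\<close> dim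
      by (auto simp: M_def)
  qed
  also have "\<dots> = real (card ?T) * M" by simp
  also have "\<dots> \<le> (\<Prod>i=1..\<sigma> - t. real CARD('a) ^ (t + i)) * M"
  proof (rule mult_right_mono[OF _ M])
    have "card ?T \<le> (\<Prod>i=1..\<sigma> - t. CARD('a) ^ (t + i))"
      using W \<open>t \<le> \<sigma>\<close> by (intro card_subspaces_of_subspace_le) auto
    then have "real (card ?T) \<le> real (\<Prod>i=1..\<sigma> - t. CARD('a) ^ (t + i))" by (simp only: of_nat_le_iff)
    then show "real (card ?T) \<le> (\<Prod>i=1..\<sigma> - t. real CARD('a) ^ (t + i))" by simp
  qed
  finally show ?thesis unfolding M_def .
qed

text \<open>A member of \<open>\<G>\<close> forces \<open>t \<le> vec.dim U\<close>. In use,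
  \<open>W\<close> is a member of the opposite family, which caps the least dimension.\<close>

lemma least_cover_exists:
  assumes \<G>: "\<G> \<noteq> {}" and W: "vec.subspace W" "\<And>G. G \<in> \<G> \<Longrightarrow> t \<le> vec.dim (W \<inter> G)"
  obtains U where "vec.subspace U" "\<And>G. G \<in> \<G> \<Longrightarrow> t \<le> vec.dim (U \<inter> G)"
    "t \<le> vec.dim U" "vec.dim U \<le> vec.dim W"
    "\<And>S. vec.subspace S \<Longrightarrow> vec.dim S < vec.dim U \<Longrightarrow> \<exists>G\<in>\<G>. vec.dim (S \<inter> G) < t"
proof -
  let ?P = "\<lambda>U. vec.subspace U \<and> (\<forall>G\<in>\<G>. t \<le> vec.dim (U \<inter> G))"
  obtain U where U: "?P U" "\<And>S. ?P S \<Longrightarrow> vec.dim U \<le> vec.dim S"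
    using ex_has_least_nat[of ?P W vec.dim] W by blast
  show thesis
  proof
    obtain G where "G \<in> \<G>" using \<G> by blast
    then show "t \<le> vec.dim U"
      using U(1) vec.dim_subset[of "U \<inter> G" U] by force
    show "vec.dim U \<le> vec.dim W" using U(2) W by blast
    show "\<exists>G\<in>\<G>. vec.dim (S \<inter> G) < t" if "vec.subspace S" "vec.dim S < vec.dim U" for S
      using that U(2)[of S] by force
  qed (use U(1) in auto)
qed

end

section \<open>Comparison of a maximum pair with the trivial pair\<close>

theorem theorem1p1:
  fixes f :: "'a::{field,finite} ^ 'n::finite \<Rightarrow> 'a ^ 'n \<Rightarrow> 'a"
    and \<nu> m1 m2 t :: nat
    and F1 F2 :: "('a ^ 'n) set set"
  assumes dimV: "CARD('n) = 2 * \<nu>"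
    and form: "bilinear_form f" "alternating_form f" "nondegenerate_form f"
    and pos: "0 < \<nu>" "0 < t"
    and ord: "m1 \<ge> m2" "m2 \<ge> t"
    and big: "2 * \<nu> \<ge> 2 * m1 + m2 + 1"
    and F1: "F1 \<subseteq> iso_subspaces f m1"
    and F2: "F2 \<subseteq> iso_subspaces f m2"
    and cross: "cross_t_intersecting F1 F2 t"
    and maximum: "\<And>G1 G2. G1 \<subseteq> iso_subspaces f m1 \<Longrightarrow> G2 \<subseteq> iso_subspaces f m2 \<Longrightarrow>
                   cross_t_intersecting G1 G2 t \<Longrightarrow> card G1 * card G2 \<le> card F1 * card F2"
  shows "\<exists>T \<in> iso_subspaces f t. \<forall>F \<in> F1 \<union> F2. T \<subseteq> F"
proof -
  interpret symplectic_form f by unfold_locales (fact form)+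
  let ?q = "CARD('a)"
  let ?N = "iso_count ?q CARD('n)"
  let ?bound = "\<lambda>m m' \<tau>. (\<Prod>i=1..\<tau> - t. real ?q ^ (t + i)) * ((real ?q ^ (m' - t + 1) - 1) ^ (\<tau> - t) * ?N \<tau> m)"
  have dims: "2 * m1 \<le> CARD('n)" "2 * m2 \<le> CARD('n)" "2 * t \<le> CARD('n)" "t \<le> m1"
    using dimV ord big by linarith+
  have N1: "0 < ?N t m1" and N2: "0 < ?N t m2"
    using iso_count_pos[OF two_le_CARD] dims by blast+
  \<comment> \<open>Some isotropic \<open>T0\<close> of dimension \<open>t\<close> exists because
    the count above the zero space is positive.\<close>
  have "{0} \<in> iso_subspaces f 0"
    by (simp add: iso_subspaces_def totally_isotropic_def)
  then have "real (card {T \<in> iso_subspaces f t. {0} \<subseteq> T}) > 0"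
    using iso_count_pos[OF two_le_CARD dims(3), of 0] card_iso_subspaces_above[of "{0}" 0 t] by simp
  then obtain T0 where T0: "T0 \<in> iso_subspaces f t"
    by (metis (no_types, lifting) card.empty empty_Collect_eq less_irrefl of_nat_0)
  \<comment> \<open>The competitor: everything above \<open>T0\<close>, with both sizes known
    exactly.\<close>
  let ?G = "\<lambda>m. {F \<in> iso_subspaces f m. T0 \<subseteq> F}"
  have "cross_t_intersecting (?G m1) (?G m2) t"
    unfolding cross_t_intersecting_def
  proof (intro ballI)
    fix A B assume "A \<in> ?G m1" "B \<in> ?G m2"
    then have "vec.dim T0 \<le> vec.dim (A \<inter> B)" by (intro vec.dim_subset) auto
    then show "t \<le> vec.dim (A \<inter> B)" using iso_subspacesD(2)[OF T0] by simp
  qed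
  then have "card (?G m1) * card (?G m2) \<le> card F1 * card F2"
    by (intro maximum) auto
  then have "real (card (?G m1) * card (?G m2)) \<le> real (card F1 * card F2)"
    by (simp only: of_nat_le_iff)
  then have max: "?N t m1 * ?N t m2 \<le> real (card F1) * real (card F2)"
    using card_iso_subspaces_above[OF T0] ord dims(4) by simp
  then have "0 < real (card F1) * real (card F2)" using mult_pos_pos[OF N1 N2] by linarith
  \<comment> \<open>A positive product makes both families nonempty; \<open>A0\<close> and
    \<open>B0\<close> then cover the opposite families.\<close>
  then obtain A0 B0 where A0: "A0 \<in> F1" and B0: "B0 \<in> F2" by fastforce
  have cross': "cross_t_intersecting F2 F1 t"
    using cross unfolding cross_t_intersecting_def by (metis Int_commute)
  have meet: "t \<le> vec.dim (A \<inter> B)" if "A \<in> F1" "B \<in> F2" for A B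
    using that cross by (auto simp: cross_t_intersecting_def)
  have A0': "vec.subspace A0" "vec.dim A0 = m1" and B0': "vec.subspace B0" "vec.dim B0 = m2"
    using A0 B0 F1 F2 by (auto dest: iso_subspacesD)
  obtain U1 where U1: "vec.subspace U1" "\<And>A. A \<in> F1 \<Longrightarrow> t \<le> vec.dim (U1 \<inter> A)"
    "t \<le> vec.dim U1" "vec.dim U1 \<le> m2"
    "\<And>S. vec.subspace S \<Longrightarrow> vec.dim S < vec.dim U1 \<Longrightarrow> \<exists>G\<in>F1. vec.dim (S \<inter> G) < t"
    using least_cover_exists[of F1 B0 t] A0 B0 B0' meet by (metis empty_iff Int_commute)
  obtain U2 where U2: "vec.subspace U2" "\<And>B. B \<in> F2 \<Longrightarrow> t \<le> vec.dim (U2 \<inter> B)"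
    "t \<le> vec.dim U2" "vec.dim U2 \<le> m1"
    "\<And>S. vec.subspace S \<Longrightarrow> vec.dim S < vec.dim U2 \<Longrightarrow> \<exists>G\<in>F2. vec.dim (S \<inter> G) < t"
    using least_cover_exists[of F2 A0 t] A0 B0 A0' meet by (metis empty_iff)
  have cf1: "real (card F1) \<le> (\<Prod>i=1..vec.dim U1 - t. real ?q ^ (t + i))
      * ((real ?q ^ (m2 - t + 1) - 1) ^ (vec.dim U2 - t) * ?N (vec.dim U2) m1)"
    using U1 U2 ord dims by (intro card_le_covers[OF F1 F2 cross, where W = U1]) auto
  have cf2: "real (card F2) \<le> (\<Prod>i=1..vec.dim U2 - t. real ?q ^ (t + i))
      * ((real ?q ^ (m1 - t + 1) - 1) ^ (vec.dim U1 - t) * ?N (vec.dim U1) m2)"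
    using U1 U2 ord dims by (intro card_le_covers[OF F2 F1 cross', where W = U2]) auto
  \<comment> \<open>The number of \<open>t\<close>-subspaces of each cover is moved to the factor of the other family.\<close>
  have "real (card F1) * real (card F2) \<le> ((\<Prod>i=1..vec.dim U1 - t. real ?q ^ (t + i))
      * ((real ?q ^ (m2 - t + 1) - 1) ^ (vec.dim U2 - t) * ?N (vec.dim U2) m1)) *
      ((\<Prod>i=1..vec.dim U2 - t. real ?q ^ (t + i))
      * ((real ?q ^ (m1 - t + 1) - 1) ^ (vec.dim U1 - t) * ?N (vec.dim U1) m2))"
    using cf1 cf2 by (rule mult_mono') auto
  also have "\<dots> = ?bound m1 m2 (vec.dim U2) * ?bound m2 m1 (vec.dim U1)"
    by (simp only: ac_simps)
  finally have prod_le: "?N t m1 * ?N t m2 \<le> ?bound m1 m2 (vec.dim U2) * ?bound m2 m1 (vec.dim U1)"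
    using max by linarith
  \<comment> \<open>The required \<open>m + m' + 1 + \<tau> \<le> CARD('n)\<close> is at worst
    \<open>big\<close> itself, as \<open>vec.dim U2 \<le> m1\<close>; the other case is no worse, as
    \<open>vec.dim U1 \<le> m2 \<le> m1\<close>.\<close>
  have "?bound m1 m2 (vec.dim U2) \<le> ?N t m1" "t < vec.dim U2 \<Longrightarrow> ?bound m1 m2 (vec.dim U2) < ?N t m1"
    using U2 ord big dimV dims by (intro cover_bound_le_iso_count two_le_CARD; simp)+
  moreover have "?bound m2 m1 (vec.dim U1) \<le> ?N t m2" "t < vec.dim U1 \<Longrightarrow> ?bound m2 m1 (vec.dim U1) < ?N t m2"
    using U1 ord big dimV dims by (intro cover_bound_le_iso_count two_le_CARD; simp)+
  moreover have "0 \<le> ?bound m2 m1 (vec.dim U1)" "0 \<le> ?bound m1 m2 (vec.dim U2)"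
    using iso_count_pos[OF two_le_CARD dims(1), of "vec.dim U2"] iso_count_pos[OF two_le_CARD dims(2), of "vec.dim U1"]
      one_le_CARD_power
    by (intro mult_nonneg_nonneg zero_le_power prod_nonneg; auto simp del: power_Suc)+
  \<comment> \<open>A least cover of dimension above \<open>t\<close> would make one factor strictly
    smaller, against \<open>prod_le\<close>.\<close>
  ultimately have "\<not> t < vec.dim U2" "\<not> t < vec.dim U1"
    using prod_le N1 N2 by (smt (verit) mult_mono mult_strict_right_mono mult_strict_left_mono mult_left_mono mult_right_mono)+
  then have dU: "vec.dim U1 = t" "vec.dim U2 = t" using U1 U2 by auto
  have contains: "U \<subseteq> A" if "vec.subspace U" "vec.dim U = t" "t \<le> vec.dim (U \<inter> A)" "vec.subspace A" for U A :: "('a ^ 'n) set"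
    using vec.subspace_dim_equal[of "U \<inter> A" U] vec.subspace_inter[of U A] that by auto
  have sub1: "U1 \<subseteq> A" if "A \<in> F1" for A
    using contains[OF U1(1) dU(1) U1(2)[OF that]] iso_subspacesD(1) that F1 by blast
  have iso: "U1 \<in> iso_subspaces f t"
    using sub1[OF A0] A0 F1 U1(1) dU(1) unfolding iso_subspaces_def totally_isotropic_def by blast
  have "U1 \<subseteq> B" if "B \<in> F2" for B
  proof (rule ccontr)
    assume "\<not> U1 \<subseteq> B"
    have B: "B \<in> iso_subspaces f m2" using that F2 by blast
    have "vec.dim (U1 \<inter> B) < t"
      using contains[of U1 B] U1(1) dU(1) iso_subspacesD(1)[OF B] \<open>\<not> U1 \<subseteq> B\<close> by (meson not_le)
    \<comment> \<open>This leaves room for an extension. If \<open>m1 = t\<close>, meeting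
      \<open>B\<close> in dimension \<open>t\<close> forces \<open>A0 \<subseteq> B\<close>, hence
      \<open>U1 \<subseteq> B\<close>.\<close>
    have "t < m1"
    proof (rule ccontr)
      assume "\<not> t < m1"
      then have "m1 = t" "m2 = t" using ord by auto
      have "A0 \<subseteq> B"
        using contains[of A0 B] A0' \<open>m1 = t\<close> meet[OF A0 that] iso_subspacesD(1)[OF B] by auto
      then show False using sub1[OF A0] \<open>\<not> U1 \<subseteq> B\<close> by blast
    qed
    \<comment> \<open>All of \<open>F1\<close> lies above \<open>U1\<close>, so one extension step
      over \<open>B\<close> bounds the whole family.\<close>
    have step: "real (card {A \<in> F1. U1 \<subseteq> A}) \<le> (real ?q ^ (m2 - t + 1) - 1) * ?N (Suc t) m1"
    proof (rule card_above_le_step[OF F1 B meet[OF _ that] U1(1) \<open>vec.dim (U1 \<inter> B) < t\<close> ord(2)])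
      fix R :: "('a ^ 'n) set" assume R: "vec.subspace R" "vec.dim R = Suc (vec.dim U1)"
      show "real (card {A \<in> F1. R \<subseteq> A}) \<le> ?N (Suc t) m1"
      proof (cases "R \<in> iso_subspaces f (Suc t)")
        case True
        have "card {A \<in> F1. R \<subseteq> A} \<le> card {A \<in> iso_subspaces f m1. R \<subseteq> A}"
          using F1 by (intro card_mono) auto
        then show ?thesis using card_iso_subspaces_above[OF True, of m1] \<open>t < m1\<close> by simp
      next
        case False
        then have none: "{A \<in> F1. R \<subseteq> A} = {}"
          using F1 R dU unfolding iso_subspaces_def totally_isotropic_def by blast
        show ?thesis unfolding none using iso_count_pos[OF two_le_CARD dims(1), of "Suc t"] by simp
      qed
    qed
    have N': "0 < ?N (Suc t) m1" using iso_count_pos[OF two_le_CARD dims(1)] .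
    have "{A \<in> F1. U1 \<subseteq> A} = F1" using sub1 by blast
    then have "real (card F1) \<le> (real ?q ^ (m2 - t + 1) - 1) * ?N (Suc t) m1" using step by simp
    also have "\<dots> < real ?q ^ (m2 - t + 1) * ?N (Suc t) m1" using N' by (intro mult_strict_right_mono) auto
    \<comment> \<open>\<open>big\<close> gives \<open>m1 + m2 + 1 \<le> CARD('n)\<close>, so
      \<open>m2 - t + 1 \<le> CARD('n) - t - m1\<close>.\<close>
    also have "\<dots> \<le> real ?q ^ (CARD('n) - t - m1) * ?N (Suc t) m1"
      using N' ord big dimV two_le_CARD by (intro mult_right_mono power_increasing) auto
    also have "\<dots> \<le> ?N t m1"
      by (rule iso_count_ge_Suc[OF two_le_CARD dims(1) \<open>t < m1\<close>])
    finally have "real (card F1) < ?N t m1" .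
    \<comment> \<open>With both covers of dimension \<open>t\<close>, the product in
      \<open>cf2\<close> is empty and the exponent is zero.\<close>
    moreover have "real (card F2) \<le> ?N t m2" using cf2 dU by simp
    ultimately have "real (card F1) * real (card F2) < ?N t m1 * ?N t m2"
      using N2 by (intro mult_less_le_imp_less) (use B0 in \<open>auto simp: card_gt_0_iff\<close>)
    then show False using max by linarith
  qed
  then show ?thesis using iso sub1 by blast
qed

end
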